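(* Let $\mathcal{C},\mathcal{D},\mathcal{C}',\mathcal{D}'$ be small connected categories and let $F,G\colon\mathcal{C}\to\mathcal{D}$ and $F',G'\colon\mathcal{C}'\to\mathcal{D}'$ be functors. Then $$\mathrm{cD}(F\times F',G\times G')+1\le \big(\mathrm{cD}(F,G)+1\big)\cdot\big(\mathrm{cD}(F',G')+1\big).$$
   Context: Interval category: for $m\ge 0$, $\mathcal{I}_m$ has objects $0,1,\dots,m$ and its only non-identity arrows are: exactly one arrow $r\to s$ whenever $r$ is even and $s=r-1$ or $s=r+1$. Two functors $F,G\colon\mathcal{C}\to\mathcal{D}$ between small categories are homotopic, $F\simeq G$, if for some $m\ge 0$ there is a functor $H\colon\mathcal{C}\times\mathcal{I}_m\to\mathcal{D}$ with $H_0=F$ and $H_m=G$ (equivalently, $F$ and $G$ are joined by a finite zigzag of natural transformations). A small category is connected if any two objects are joined by a finite zigzag of arrows. Members of covers (subcategories) are not required to be connected. Geometric cover: a collection $\{\mathcal{U}_\lambda\}_{\lambda\in\Lambda}$ of subcategories of $\mathcal{C}$ such that for every sequence of composable arrows $f_1,\dots,f_n$ in $\mathcal{C}$ there is $\lambda\in\Lambda$ such that every $f_i$ belongs to $\mathcal{U}_\lambda$. Categorical homotopic distance: for functors $F,G\colon\mathcal{C}\to\mathcal{D}$, $\mathrm{cD}(F,G)$ is the least integer $n\ge 0$ such that there is a geometric cover $\{\mathcal{U}_0,\dots,\mathcal{U}_n\}$ of $\mathcal{C}$ with $F_{|\mathcal{U}_j}\simeq G_{|\mathcal{U}_j}$ for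 all $j$; it is $\infty$ if there is no such cover. $F\times F'\colon\mathcal{C}\times\mathcal{C}'\to\mathcal{D}\times\mathcal{D}'$ denotes the product functor. *)

theory Defs
  imports "HOL-Library.Extended_Nat"
begin

text \<open>A small category is given by a set of objects and a set of arrows inside arbitrary types;
  the structure maps are only meaningful on these sets. Composition is written in
  the applicative order: \<open>Comp C g f\<close> is \<open>g\<close> after \<open>f\<close>.\<close>

record ('o, 'a) category_data =
  Obj :: "'o set"
  Arr :: "'a set"
  Dom :: "'a \<Rightarrow> 'o"
  Cod :: "'a \<Rightarrow> 'o"
  Id :: "'o \<Rightarrow> 'a"
  Comp :: "'a \<Rightarrow> 'a \<Rightarrow> 'a"

locale category =
  fixes C :: "('o, 'a) category_data"
  assumes dom_obj: "f \<in> Arr C \<Longrightarrow> Dom C f \<in> Obj C"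
    and cod_obj: "f \<in> Arr C \<Longrightarrow> Cod C f \<in> Obj C"
    and id_arr: "x \<in> Obj C \<Longrightarrow> Id C x \<in> Arr C"
    and dom_id: "x \<in> Obj C \<Longrightarrow> Dom C (Id C x) = x"
    and cod_id: "x \<in> Obj C \<Longrightarrow> Cod C (Id C x) = x"
    and comp_arr: "\<lbrakk>f \<in> Arr C; g \<in> Arr C; Cod C f = Dom C g\<rbrakk> \<Longrightarrow> Comp C g f \<in> Arr C"
    and dom_comp: "\<lbrakk>f \<in> Arr C; g \<in> Arr C; Cod C f = Dom C g\<rbrakk> \<Longrightarrow> Dom C (Comp C g f) = Dom C f"
    and cod_comp: "\<lbrakk>f \<in> Arr C; g \<in> Arr C; Cod C f = Dom C g\<rbrakk> \<Longrightarrow> Cod C (Comp C g f) = Cod C g"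
    and comp_id_right: "f \<in> Arr C \<Longrightarrow> Comp C f (Id C (Dom C f)) = f"
    and comp_id_left: "f \<in> Arr C \<Longrightarrow> Comp C (Id C (Cod C f)) f = f"
    and comp_assoc: "\<lbrakk>f \<in> Arr C; g \<in> Arr C; h \<in> Arr C; Cod C f = Dom C g; Cod C g = Dom C h\<rbrakk>
      \<Longrightarrow> Comp C h (Comp C g f) = Comp C (Comp C h g) f"

text \<open>Zigzags are encoded by the reflexive transitive closure of the relation
  ``there is an arrow in one of the two directions''.\<close>

definition connected_category :: "('o, 'a) category_data \<Rightarrow> bool" where
  "connected_category C \<longleftrightarrow> category C \<and>
     (\<forall>x\<in>Obj C. \<forall>y\<in>Obj C.
        (x, y) \<in> {(u, v). \<exists>f\<in>Arr C. (Dom C f = u \<and> Cod C f = v) \<or> (Dom C f = v \<and> Cod C f = u)}\<^sup>*)"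

record ('o, 'a, 'p, 'b) functor_data =
  FObj :: "'o \<Rightarrow> 'p"
  FArr :: "'a \<Rightarrow> 'b"

locale cat_functor = source: category C + target: category D
  for C :: "('o, 'a) category_data" and D :: "('p, 'b) category_data" +
  fixes F :: "('o, 'a, 'p, 'b) functor_data"
  assumes map_obj: "x \<in> Obj C \<Longrightarrow> FObj F x \<in> Obj D"
    and map_arr: "f \<in> Arr C \<Longrightarrow> FArr F f \<in> Arr D"
    and map_dom: "f \<in> Arr C \<Longrightarrow> Dom D (FArr F f) = FObj F (Dom C f)"
    and map_cod: "f \<in> Arr C \<Longrightarrow> Cod D (FArr F f) = FObj F (Cod C f)"
    and map_id: "x \<in> Obj C \<Longrightarrow> FArr F (Id C x) = Id D (FObj F x)"
    and map_comp: "\<lbrakk>f \<in> Arr C; g \<in> Arr C; Cod C f = Dom C g\<rbrakk>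
      \<Longrightarrow> FArr F (Comp C g f) = Comp D (FArr F g) (FArr F f)"

text \<open>Equality of functors with source \<open>C\<close>: values outside \<open>C\<close> are irrelevant. In particular
  the restriction of a functor to a subcategory \<open>U\<close> is the same data regarded as a functor
  with source \<open>U\<close>.\<close>

definition functor_eq_on ::
  "('o, 'a) category_data \<Rightarrow> ('o, 'a, 'p, 'b) functor_data \<Rightarrow> ('o, 'a, 'p, 'b) functor_data \<Rightarrow> bool"
where
  "functor_eq_on C F G \<longleftrightarrow>
     (\<forall>x\<in>Obj C. FObj F x = FObj G x) \<and> (\<forall>f\<in>Arr C. FArr F f = FArr G f)"

definition prod_cat ::
  "('o, 'a) category_data \<Rightarrow> ('p, 'b) category_data \<Rightarrow> ('o \<times> 'p, 'a \<times> 'b) category_data"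
where
  "prod_cat C D =
     \<lparr>Obj = Obj C \<times> Obj D,
      Arr = Arr C \<times> Arr D,
      Dom = map_prod (Dom C) (Dom D),
      Cod = map_prod (Cod C) (Cod D),
      Id = map_prod (Id C) (Id D),
      Comp = (\<lambda>(g, g') (f, f'). (Comp C g f, Comp D g' f'))\<rparr>"

definition prod_functor ::
  "('o, 'a, 'p, 'b) functor_data \<Rightarrow> ('o2, 'a2, 'p2, 'b2) functor_data
     \<Rightarrow> ('o \<times> 'o2, 'a \<times> 'a2, 'p \<times> 'p2, 'b \<times> 'b2) functor_data"
where
  "prod_functor F F' =
     \<lparr>FObj = map_prod (FObj F) (FObj F'), FArr = map_prod (FArr F) (FArr F')\<rparr>"

text \<open>There is at most one arrow between two objects of the interval category,
  so an arrow \<open>r \<rightarrow> s\<close> is encoded as the pair \<open>(r, s)\<close>; identities are the pairs \<open>(r, r)\<close>.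
  Of two composable arrows at least one is an identity.\<close>

definition interval_cat :: "nat \<Rightarrow> (nat, nat \<times> nat) category_data" where
  "interval_cat m =
     \<lparr>Obj = {0..m},
      Arr = {(r, s). r \<le> m \<and> s \<le> m \<and> (r = s \<or> even r \<and> (r = s + 1 \<or> s = r + 1))},
      Dom = fst,
      Cod = snd,
      Id = (\<lambda>r. (r, r)),
      Comp = (\<lambda>(s', t) (r, s). (r, t))\<rparr>"

text \<open>The functor \<open>H\<^sub>i\<close> obtained by restricting \<open>H\<close>, with source \<open>C \<times> I\<^sub>m\<close>, to the object \<open>i\<close>
  and its identity.\<close>

definition slice ::
  "('o \<times> nat, 'a \<times> (nat \<times> nat), 'p, 'b) functor_data \<Rightarrow> nat \<Rightarrow> ('o, 'a, 'p, 'b) functor_data"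
where
  "slice H i = \<lparr>FObj = (\<lambda>x. FObj H (x, i)), FArr = (\<lambda>f. FArr H (f, (i, i)))\<rparr>"

definition homotopic ::
  "('o, 'a) category_data \<Rightarrow> ('p, 'b) category_data
     \<Rightarrow> ('o, 'a, 'p, 'b) functor_data \<Rightarrow> ('o, 'a, 'p, 'b) functor_data \<Rightarrow> bool"
where
  "homotopic C D F G \<longleftrightarrow> cat_functor C D F \<and> cat_functor C D G \<and>
     (\<exists>m H. cat_functor (prod_cat C (interval_cat m)) D H \<and>
        functor_eq_on C (slice H 0) F \<and> functor_eq_on C (slice H m) G)"

definition subcategory :: "('o, 'a) category_data \<Rightarrow> ('o, 'a) category_data \<Rightarrow> bool" where
  "subcategory U C \<longleftrightarrow> category U \<and> category C \<and> Obj U \<subseteq> Obj C \<and> Arr U \<subseteq> Arr C \<and>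
     (\<forall>f\<in>Arr U. Dom U f = Dom C f \<and> Cod U f = Cod C f) \<and>
     (\<forall>x\<in>Obj U. Id U x = Id C x) \<and>
     (\<forall>f\<in>Arr U. \<forall>g\<in>Arr U. Cod U f = Dom U g \<longrightarrow> Comp U g f = Comp C g f)"

text \<open>A sequence \<open>f\<^sub>1, \<dots>, f\<^sub>n\<close> with \<open>n \<ge> 1\<close>, each \<open>f\<^sub>i\<close> starting where \<open>f\<^bsub>i-1\<^esub>\<close> ends.\<close>

definition composable_seq :: "('o, 'a) category_data \<Rightarrow> 'a list \<Rightarrow> bool" where
  "composable_seq C fs \<longleftrightarrow>
     fs \<noteq> [] \<and> set fs \<subseteq> Arr C \<and> successively (\<lambda>f g. Cod C f = Dom C g) fs"

definition geometric_cover ::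
  "('o, 'a) category_data \<Rightarrow> 'l set \<Rightarrow> ('l \<Rightarrow> ('o, 'a) category_data) \<Rightarrow> bool"
where
  "geometric_cover C \<Lambda> U \<longleftrightarrow>
     (\<forall>l\<in>\<Lambda>. subcategory (U l) C) \<and>
     (\<forall>fs. composable_seq C fs \<longrightarrow> (\<exists>l\<in>\<Lambda>. set fs \<subseteq> Arr (U l)))"

text \<open>The infimum in \<^typ>\<open>enat\<close> is the least element of a nonempty set, and \<open>\<infinity>\<close> for
  the empty set.\<close>

definition cD ::
  "('o, 'a) category_data \<Rightarrow> ('p, 'b) category_data
     \<Rightarrow> ('o, 'a, 'p, 'b) functor_data \<Rightarrow> ('o, 'a, 'p, 'b) functor_data \<Rightarrow> enat"
where
  "cD C D F G = Inf {enat n | n. \<exists>U :: nat \<Rightarrow> ('o, 'a) category_data.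
     geometric_cover C {0..n} U \<and> (\<forall>j\<in>{0..n}. homotopic (U j) D F G)}"

lemma category_prod_cat:
  assumes "category C" "category D"
  shows "category (prod_cat C D)"
proof -
  interpret C: category C by fact
  interpret D: category D by fact
  show ?thesis
    by unfold_locales
      (auto simp: prod_cat_def C.dom_obj D.dom_obj C.cod_obj D.cod_obj C.id_arr D.id_arr
        C.dom_id D.dom_id C.cod_id D.cod_id C.comp_arr D.comp_arr C.dom_comp D.dom_comp
        C.cod_comp D.cod_comp C.comp_id_right D.comp_id_right C.comp_id_left D.comp_id_left
        C.comp_assoc D.comp_assoc)
qed

lemma category_interval_cat: "category (interval_cat m)"
  by unfold_locales (auto simp: interval_cat_def)

lemma cat_functor_prod_functor:
  assumes "cat_functor C D F" "cat_functor C' D' F'"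
  shows "cat_functor (prod_cat C C') (prod_cat D D') (prod_functor F F')"
proof -
  interpret F: cat_functor C D F by fact
  interpret F': cat_functor C' D' F' by fact
  interpret S: category "prod_cat C C'"
    by (intro category_prod_cat F.source.category_axioms F'.source.category_axioms)
  interpret T: category "prod_cat D D'"
    by (intro category_prod_cat F.target.category_axioms F'.target.category_axioms)
  show ?thesis
    by unfold_locales
      (auto simp: prod_cat_def prod_functor_def F.map_obj F'.map_obj F.map_arr F'.map_arr
        F.map_dom F'.map_dom F.map_cod F'.map_cod F.map_id F'.map_id F.map_comp F'.map_comp)
qed

end

theory Submission
  imports Defs
begin

text \<open>
  If \<open>\<U>\<close> is a geometric cover of \<open>C\<close> with \<open>n + 1\<close> members and \<open>\<V>\<close> one of \<open>C'\<close> with \<open>n' + 1\<close>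
  members, then the products \<open>U \<times> V\<close> with \<open>U\<close> in \<open>\<U>\<close> and \<open>V\<close> in \<open>\<V>\<close> form a geometric cover of
  \<open>C \<times> C'\<close> with \<open>(n + 1) (n' + 1)\<close> members: both coordinate sequences of a composable sequence are
  composable, and members containing them are chosen independently
  (\<open>geometric_cover_prod\<close>).

  On \<open>U \<times> V\<close> a homotopy from \<open>F \<times> F'\<close> to \<open>G \<times> G'\<close> is obtained by running a homotopy \<open>H\<close> from
  \<open>F\<close> to \<open>G\<close> and a homotopy \<open>H'\<close> from \<open>F'\<close> to \<open>G'\<close> simultaneously (\<open>homotopic_prod\<close>). This requires
  both to have the same length, which is arranged by letting the shorter one rest at its end
  (\<open>cat_functor_rest\<close>). Concatenating \<open>H \<times> F'\<close> with \<open>G \<times> H'\<close> would also do, but the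
  orientation of the arrows of the second interval would then depend on the parity of the length
  of the first.

  The inequality is then an estimate of infima. If one of the distances is infinite, the right-hand
  side is infinite because the other factor is at least \<open>1\<close>.
\<close>

text \<open>The truncation \<open>i \<mapsto> min i m\<close> is a functor from the interval of length \<open>M\<close> onto the one of
  length \<open>m\<close>, since it either keeps an arrow or sends it to the identity of \<open>m\<close>. The functor below is
  \<open>H\<close> precomposed with it.\<close>

definition rest_at ::
  "nat \<Rightarrow> ('o \<times> nat, 'a \<times> (nat \<times> nat), 'p, 'b) functor_data
     \<Rightarrow> ('o \<times> nat, 'a \<times> (nat \<times> nat), 'p, 'b) functor_data"
where
  "rest_at m H =
     \<lparr>FObj = (\<lambda>(x, i). FObj H (x, min i m)),
      FArr = (\<lambda>(f, (r, s)). FArr H (f, (min r m, min s m)))\<rparr>"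

lemma cat_functor_rest:
  assumes C: "category C"
    and H: "cat_functor (prod_cat C (interval_cat m)) D H" and "m \<le> M"
  shows "cat_functor (prod_cat C (interval_cat M)) D (rest_at m H)"
proof -
  interpret H: cat_functor "prod_cat C (interval_cat m)" D H by fact
  interpret S: category "prod_cat C (interval_cat M)"
    by (intro category_prod_cat C category_interval_cat)
  have arr: "(f, (min r m, min s m)) \<in> Arr (prod_cat C (interval_cat m))"
    if "(f, (r, s)) \<in> Arr (prod_cat C (interval_cat M))" for f r s
    using that by (auto simp: prod_cat_def interval_cat_def min_def)
  show ?thesis
  proof (unfold_locales, goal_cases)
    case (1 x)
    then show ?case
      using H.map_obj[of "(fst x, min (snd x) m)"]
      by (auto simp: rest_at_def prod_cat_def interval_cat_def)
  next
    case (2 f)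
    then show ?case
      by (cases f) (auto simp: rest_at_def intro: H.map_arr arr)
  next
    case (3 f)
    then show ?case
      using H.map_dom[OF arr]
      by (cases f) (auto simp: rest_at_def prod_cat_def interval_cat_def)
  next
    case (4 f)
    then show ?case
      using H.map_cod[OF arr]
      by (cases f) (auto simp: rest_at_def prod_cat_def interval_cat_def)
  next
    case (5 x)
    then show ?case
      using H.map_id[of "(fst x, min (snd x) m)"]
      by (auto simp: rest_at_def prod_cat_def interval_cat_def)
  next
    case (6 f g)
    obtain f0 r s where f: "f = (f0, (r, s))" by (cases f)
    obtain g0 r' s' where g: "g = (g0, (r', s'))" by (cases g)
    show ?case
      using 6 H.map_comp[OF arr arr, of f0 r s g0 r' s']
      by (auto simp: f g rest_at_def prod_cat_def interval_cat_def)
  qed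
qed

text \<open>Since every sufficiently large length is available, finitely many homotopies can be
  given one common length.\<close>

lemma homotopic_all_large_lengths:
  assumes "homotopic C D F G"
  shows "\<exists>m. \<forall>M\<ge>m. \<exists>H. cat_functor (prod_cat C (interval_cat M)) D H \<and>
           functor_eq_on C (slice H 0) F \<and> functor_eq_on C (slice H M) G"
proof -
  interpret F: cat_functor C D F
    using assms by (simp add: homotopic_def)
  obtain m H where H: "cat_functor (prod_cat C (interval_cat m)) D H"
    and ends: "functor_eq_on C (slice H 0) F" "functor_eq_on C (slice H m) G"
    using assms by (auto simp: homotopic_def)
  show ?thesis
  proof (intro exI[of _ m] allI impI)
    fix M assume "m \<le> M"
    with ends
    have "functor_eq_on C (slice (rest_at m H) 0) F"
         "functor_eq_on C (slice (rest_at m H) M) G"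
      by (auto simp: functor_eq_on_def slice_def rest_at_def min_absorb2)
    with cat_functor_rest[OF F.source.category_axioms H \<open>m \<le> M\<close>]
    show "\<exists>H. cat_functor (prod_cat C (interval_cat M)) D H \<and>
        functor_eq_on C (slice H 0) F \<and> functor_eq_on C (slice H M) G"
      by blast
  qed
qed

definition parallel_homotopy ::
  "('o \<times> nat, 'a \<times> (nat \<times> nat), 'p, 'b) functor_data
     \<Rightarrow> ('o2 \<times> nat, 'a2 \<times> (nat \<times> nat), 'p2, 'b2) functor_data
     \<Rightarrow> (('o \<times> 'o2) \<times> nat, ('a \<times> 'a2) \<times> (nat \<times> nat), 'p \<times> 'p2, 'b \<times> 'b2) functor_data"
where
  "parallel_homotopy H H' =
     \<lparr>FObj = (\<lambda>((x, y), i). (FObj H (x, i), FObj H' (y, i))),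
      FArr = (\<lambda>((f, g), u). (FArr H (f, u), FArr H' (g, u)))\<rparr>"

lemma cat_functor_parallel_homotopy:
  assumes "category C" "category C'"
    and "cat_functor (prod_cat C (interval_cat m)) D H"
    and "cat_functor (prod_cat C' (interval_cat m)) D' H'"
  shows "cat_functor (prod_cat (prod_cat C C') (interval_cat m)) (prod_cat D D')
           (parallel_homotopy H H')"
proof -
  interpret H: cat_functor "prod_cat C (interval_cat m)" D H by fact
  interpret H': cat_functor "prod_cat C' (interval_cat m)" D' H' by fact
  interpret S: category "prod_cat (prod_cat C C') (interval_cat m)"
    by (intro category_prod_cat category_interval_cat assms)
  interpret T: category "prod_cat D D'"
    by (intro category_prod_cat H.target.category_axioms H'.target.category_axioms)
  note maps = H.map_obj H.map_arr H.map_dom H.map_cod H'.map_obj H'.map_arr H'.map_dom H'.map_cod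
  show ?thesis
  proof (unfold_locales, goal_cases)
    case (5 x)
    then show ?case
      using H.map_id[of "(fst (fst x), snd x)"] H'.map_id[of "(snd (fst x), snd x)"]
      by (auto simp: parallel_homotopy_def prod_cat_def)
  next
    case (6 f g)
    obtain f1 f2 u where f: "f = ((f1, f2), u)" by (cases f) auto
    obtain g1 g2 v where g: "g = ((g1, g2), v)" by (cases g) auto
    show ?case
      using 6 H.map_comp[of "(f1, u)" "(g1, v)"] H'.map_comp[of "(f2, u)" "(g2, v)"]
      by (auto simp: f g parallel_homotopy_def prod_cat_def)
  qed (auto simp: maps parallel_homotopy_def prod_cat_def)
qed

lemma homotopic_prod:
  assumes h: "homotopic C D F G" and h': "homotopic C' D' F' G'"
  shows "homotopic (prod_cat C C') (prod_cat D D') (prod_functor F F') (prod_functor G G')"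
proof -
  have functors: "cat_functor C D F" "cat_functor C D G" "cat_functor C' D' F'" "cat_functor C' D' G'"
    using h h' by (auto simp: homotopic_def)
  then have cats: "category C" "category C'"
    by (auto simp: cat_functor_def)
  obtain m where m: "\<forall>M\<ge>m. \<exists>H. cat_functor (prod_cat C (interval_cat M)) D H \<and>
      functor_eq_on C (slice H 0) F \<and> functor_eq_on C (slice H M) G"
    using homotopic_all_large_lengths[OF h] ..
  obtain m' where m': "\<forall>M\<ge>m'. \<exists>H. cat_functor (prod_cat C' (interval_cat M)) D' H \<and>
      functor_eq_on C' (slice H 0) F' \<and> functor_eq_on C' (slice H M) G'"
    using homotopic_all_large_lengths[OF h'] ..
  define M where "M = max m m'"
  then have "m \<le> M" "m' \<le> M"
    by simp_all
  obtain H where H: "cat_functor (prod_cat C (interval_cat M)) D H"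
      "functor_eq_on C (slice H 0) F" "functor_eq_on C (slice H M) G"
    using m \<open>m \<le> M\<close> by blast
  obtain H' where H': "cat_functor (prod_cat C' (interval_cat M)) D' H'"
      "functor_eq_on C' (slice H' 0) F'" "functor_eq_on C' (slice H' M) G'"
    using m' \<open>m' \<le> M\<close> by blast
  have "functor_eq_on (prod_cat C C') (slice (parallel_homotopy H H') 0) (prod_functor F F')"
       "functor_eq_on (prod_cat C C') (slice (parallel_homotopy H H') M) (prod_functor G G')"
    using H(2,3) H'(2,3)
    by (auto simp: functor_eq_on_def slice_def parallel_homotopy_def prod_functor_def prod_cat_def)
  then show ?thesis
    unfolding homotopic_def
    using cat_functor_parallel_homotopy[OF cats H(1) H'(1)] functors
    by (blast intro: cat_functor_prod_functor)
qed

lemma subcategory_prod: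
  assumes "subcategory U C" "subcategory V C'"
  shows "subcategory (prod_cat U V) (prod_cat C C')"
  using assms
  unfolding subcategory_def
  by (intro conjI category_prod_cat; force simp: prod_cat_def)

lemma composable_seq_prodD:
  assumes "composable_seq (prod_cat C C') fs"
  shows "composable_seq C (map fst fs)" "composable_seq C' (map snd fs)"
proof -
  have "successively (\<lambda>p q. Cod C (fst p) = Dom C (fst q) \<and> Cod C' (snd p) = Dom C' (snd q)) fs"
    using assms by (simp add: composable_seq_def prod_cat_def map_prod_def case_prod_beta)
  then have "successively (\<lambda>p q. Cod C (fst p) = Dom C (fst q)) fs"
    "successively (\<lambda>p q. Cod C' (snd p) = Dom C' (snd q)) fs"
    by (simp_all add: successively_conv_nth)
  with assms show "composable_seq C (map fst fs)" "composable_seq C' (map snd fs)"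
    by (auto simp: composable_seq_def successively_map prod_cat_def)
qed

lemma geometric_cover_prod:
  assumes U: "geometric_cover C L U" and V: "geometric_cover C' L' V"
  shows "geometric_cover (prod_cat C C') (L \<times> L') (\<lambda>(l, l'). prod_cat (U l) (V l'))"
  unfolding geometric_cover_def
proof (intro conjI allI impI)
  show "\<forall>l\<in>L \<times> L'. subcategory (case l of (l, l') \<Rightarrow> prod_cat (U l) (V l')) (prod_cat C C')"
    using U V by (auto simp: geometric_cover_def intro: subcategory_prod)
next
  fix fs assume "composable_seq (prod_cat C C') fs"
  note seqs = composable_seq_prodD[OF this]
  obtain l where l: "l \<in> L" "fst ` set fs \<subseteq> Arr (U l)"
    using U seqs(1) by (fastforce simp: geometric_cover_def)
  obtain l' where l': "l' \<in> L'" "snd ` set fs \<subseteq> Arr (V l')"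
    using V seqs(2) by (fastforce simp: geometric_cover_def)
  have "set fs \<subseteq> Arr (prod_cat (U l) (V l'))"
    using l(2) l'(2) by (auto simp: prod_cat_def image_subset_iff)
  with l(1) l'(1)
  show "\<exists>l\<in>L \<times> L'. set fs \<subseteq> Arr (case l of (l, l') \<Rightarrow> prod_cat (U l) (V l'))"
    by (intro bexI[of _ "(l, l')"]) simp_all
qed

lemma geometric_cover_reindex:
  assumes "geometric_cover C L U" and "e ` K = L"
  shows "geometric_cover C K (U \<circ> e)"
  using assms by (fastforce simp: geometric_cover_def)

text \<open>Arbitrary finite index sets are admitted here because product covers are naturally
  indexed by pairs.\<close>

lemma cD_le:
  assumes "geometric_cover C L U" "finite L" "card L = Suc n"
    and "\<And>l. l \<in> L \<Longrightarrow> homotopic (U l) D F G"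
  shows "cD C D F G \<le> enat n"
proof -
  obtain e where "bij_betw e {0..<Suc n} L"
    using ex_bij_betw_nat_finite[OF assms(2)] assms(3) by auto
  then have e: "e ` {0..n} = L"
    by (simp add: bij_betw_def atLeastLessThanSuc_atLeastAtMost)
  have "geometric_cover C {0..n} (U \<circ> e)"
    using geometric_cover_reindex[OF assms(1) e] .
  moreover have "\<forall>j\<in>{0..n}. homotopic ((U \<circ> e) j) D F G"
    using e assms(4) by auto
  ultimately show ?thesis
    unfolding cD_def by (blast intro: Inf_lower)
qed

text \<open>A finite infimum in the extended naturals comes from a nonempty set, and by
  well-foundedness it belongs to that set.\<close>

lemma cD_attained:
  fixes C :: "('o, 'a) category_data"
  assumes "cD C D F G = enat n"
  shows "\<exists>U :: nat \<Rightarrow> ('o, 'a) category_data.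
           geometric_cover C {0..n} U \<and> (\<forall>j\<in>{0..n}. homotopic (U j) D F G)"
proof -
  define S where "S = {enat n | n. \<exists>U :: nat \<Rightarrow> ('o, 'a) category_data.
     geometric_cover C {0..n} U \<and> (\<forall>j\<in>{0..n}. homotopic (U j) D F G)}"
  have Inf_S: "Inf S = enat n"
    using assms by (simp add: S_def cD_def)
  then have "S \<noteq> {}"
    by (auto simp: Inf_enat_def)
  then have "Inf S \<in> S"
    by (auto simp: Inf_enat_def intro: LeastI)
  with Inf_S show ?thesis
    by (auto simp: S_def)
qed

theorem theorem4p14:
  fixes C :: "('o1, 'a1) category_data" and D :: "('o2, 'a2) category_data"
    and C' :: "('o3, 'a3) category_data" and D' :: "('o4, 'a4) category_data"
    and F G :: "('o1, 'a1, 'o2, 'a2) functor_data"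
    and F' G' :: "('o3, 'a3, 'o4, 'a4) functor_data"
  assumes "connected_category C" and "connected_category D"
    and "connected_category C'" and "connected_category D'"
    and "cat_functor C D F" and "cat_functor C D G"
    and "cat_functor C' D' F'" and "cat_functor C' D' G'"
  shows "cD (prod_cat C C') (prod_cat D D') (prod_functor F F') (prod_functor G G') + 1
           \<le> (cD C D F G + 1) * (cD C' D' F' G' + 1)"
proof (cases "cD C D F G = \<infinity> \<or> cD C' D' F' G' = \<infinity>")
  case True
  then have "(cD C D F G + 1) * (cD C' D' F' G' + 1) = \<infinity>"
    by (auto simp: imult_is_infinity)
  then show ?thesis by simp
next
  case False
  then obtain n n' where n: "cD C D F G = enat n" and n': "cD C' D' F' G' = enat n'"
    by auto
  obtain U where U: "geometric_cover C {0..n} U"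
    and hU: "\<forall>j\<in>{0..n}. homotopic (U j) D F G"
    using cD_attained[OF n] by blast
  obtain V where V: "geometric_cover C' {0..n'} V"
    and hV: "\<forall>j\<in>{0..n'}. homotopic (V j) D' F' G'"
    using cD_attained[OF n'] by blast
  \<comment> \<open>One less than \<open>(n + 1) (n' + 1)\<close>, as a cover for the distance \<open>N\<close> has \<open>N + 1\<close> members.\<close>
  define N where "N = n * n' + n + n'"
  have "cD (prod_cat C C') (prod_cat D D') (prod_functor F F') (prod_functor G G') \<le> enat N"
  proof (rule cD_le[OF geometric_cover_prod[OF U V]])
    show "card ({0..n} \<times> {0..n'}) = Suc N"
      by (simp add: N_def)
  qed (use hU hV in \<open>auto intro: homotopic_prod\<close>)
  then have "cD (prod_cat C C') (prod_cat D D') (prod_functor F F') (prod_functor G G') + 1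
      \<le> enat N + 1"
    by (rule add_right_mono)
  also have "\<dots> = (enat n + 1) * (enat n' + 1)"
    by (simp add: N_def one_enat_def algebra_simps)
  finally show ?thesis
    by (simp add: n n')
qed

end
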